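(* Let $\Sigma=\mathrm{Diag}(\sigma_1,\dots,\sigma_n)$ with $\sigma_1\ge\dots\ge\sigma_n\ge0$. Let $\Omega\in\mathbb{R}^{n\times k}$ be a random matrix whose elements are independently identically distributed according to the normal distribution $\mathcal{N}(0,\frac1k)$. Then for any $x\in\mathbb{R}^n$ the quadratic form $$q(x)=x^\top(I+\Sigma^2)^{-\frac12}(I+\Sigma\Omega\Omega^\top\Sigma)(I+\Sigma^2)^{-\frac12}x$$ has expected value $\mathbb{E}(q(x))=\|x\|^2$ and variance $$\mathrm{Var}(q(x))=\frac{2}{k}\Big(\sum_{i=1}^{n}\frac{\sigma_i^2}{1+\sigma_i^2}x_i^2\Big)^2.$$
   Context: $\mathcal{N}(\mu,s^2)$ denotes the normal distribution with mean $\mu$ and standard deviation $s$ (variance $s^2$); $\|\cdot\|$ is the Euclidean norm and $I$ the identity matrix of order $n$. *)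

theory Defs
  imports "HOL-Probability.Probability"
begin

definition diag_matrix :: "real ^ 'n \<Rightarrow> real ^ 'n ^ 'n" where
  "diag_matrix v = (\<chi> i j. if i = j then v $ i else 0)"

definition quad_form :: "real ^ 'n ^ 'n \<Rightarrow> real ^ 'n \<Rightarrow> real" where
  "quad_form A x = x \<bullet> (A *v x)"

definition pos_semidef :: "real ^ 'n ^ 'n \<Rightarrow> bool" where
  "pos_semidef A \<longleftrightarrow> transpose A = A \<and> (\<forall>x. 0 \<le> quad_form A x)"

(* The principal square root; it exists and is unique when A is positive semidefinite,
   and is unspecified otherwise. *)
definition matrix_sqrt :: "real ^ 'n ^ 'n \<Rightarrow> real ^ 'n ^ 'n" where
  "matrix_sqrt A = (THE B. pos_semidef B \<and> B ** B = A)"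

(* The power -1/2, meaningful for positive definite A. *)
definition matrix_inv_sqrt :: "real ^ 'n ^ 'n \<Rightarrow> real ^ 'n ^ 'n" where
  "matrix_inv_sqrt A = matrix_inv (matrix_sqrt A)"

definition sketched_matrix :: "real ^ 'n ^ 'n \<Rightarrow> real ^ 'k ^ 'n \<Rightarrow> real ^ 'n ^ 'n" where
  "sketched_matrix S W =
     matrix_inv_sqrt (mat 1 + S ** S)
     ** (mat 1 + S ** W ** transpose W ** S)
     ** matrix_inv_sqrt (mat 1 + S ** S)"

end

theory Submission
  imports Defs
begin

text \<open>
  Write \<open>D = Diag(\<sigma>)\<close>, \<open>R\<close> for the inverse square root of \<open>I + D\<^sup>2\<close>, and \<open>a = D R x\<close>, so that
  \<open>a\<^sub>i = \<sigma>\<^sub>i x\<^sub>i / sqrt (1 + \<sigma>\<^sub>i\<^sup>2)\<close>. All matrices except \<open>\<Omega>\<close> are diagonal, hence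
  \<open>q(x) = \<parallel>R x\<parallel>\<^sup>2 + \<parallel>\<Omega>\<^sup>T a\<parallel>\<^sup>2\<close>: a constant plus the sum over the columns \<open>j\<close> of \<open>Y\<^sub>j\<^sup>2\<close>, with
  \<open>Y\<^sub>j = (\<Sum>i. a\<^sub>i \<Omega>\<^sub>i\<^sub>j)\<close> (lemma \<open>quad_form_sketched_matrix_diag\<close>).

  Each \<open>Y\<^sub>j\<close> is a linear combination of independent centred Gaussians, so it is Gaussian
  (possibly degenerate) with mean 0 and variance \<open>v = \<parallel>a\<parallel>\<^sup>2 / k\<close>; therefore \<open>Y\<^sub>j\<^sup>2\<close> has mean \<open>v\<close> and, since the fourth
  moment is \<open>3 v\<^sup>2\<close>, variance \<open>2 v\<^sup>2\<close>. Different columns of \<open>\<Omega>\<close> share no entry, so the \<open>Y\<^sub>j\<close> are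
  independent and their variances add (Bienayme's identity). Summing over the \<open>k\<close> columns gives
  mean \<open>\<parallel>R x\<parallel>\<^sup>2 + \<parallel>a\<parallel>\<^sup>2 = \<parallel>x\<parallel>\<^sup>2\<close> and variance \<open>2 k v\<^sup>2 = (2/k) \<parallel>a\<parallel>\<^sup>4\<close>.

  On the matrix side, the principal square root is defined by a unique-existence description, so
  evaluating it on a diagonal matrix requires the uniqueness of positive semidefinite square roots;
  for a diagonal matrix this has an elementary proof that avoids the spectral theorem
  (lemma \<open>matrix_sqrt_diag\<close>).
\<close>

section \<open>Functions of diagonal matrices\<close>

lemma diag_matrix_mult_vec: "(diag_matrix d *v x) $ i = d $ i * x $ i"
  unfolding diag_matrix_def matrix_vector_mult_def
  by (simp add: if_distrib[of "\<lambda>c. c * _"] cong: if_cong)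

lemma diag_matrix_mult: "diag_matrix c ** diag_matrix d = diag_matrix (\<chi> i. c $ i * d $ i)"
  by (subst matrix_eq) (simp add: vec_eq_iff diag_matrix_mult_vec flip: matrix_vector_mul_assoc)

lemma diag_matrix_add: "diag_matrix c + diag_matrix d = diag_matrix (c + d)"
  by (simp add: diag_matrix_def vec_eq_iff)

lemma mat_1_eq_diag_matrix: "mat 1 = diag_matrix (\<chi> i. 1)"
  by (simp add: diag_matrix_def vec_eq_iff mat_def)

lemma transpose_diag_matrix: "transpose (diag_matrix d) = diag_matrix d"
  by (auto simp: diag_matrix_def vec_eq_iff transpose_def)

lemma symmetric_inner_mult:
  fixes A :: "real ^ 'n ^ 'n"
  assumes "transpose A = A"
  shows "u \<bullet> (A *v w) = (A *v u) \<bullet> w"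
  by (metis assms dot_lmul_matrix transpose_matrix_vector)

lemma pos_semidef_diag_matrix:
  assumes "\<And>i. 0 \<le> d $ i"
  shows "pos_semidef (diag_matrix d)"
  unfolding pos_semidef_def quad_form_def
proof (intro conjI allI)
  fix x
  have "x \<bullet> (diag_matrix d *v x) = (\<Sum>i\<in>UNIV. d $ i * (x $ i)\<^sup>2)"
    by (simp add: inner_vec_def diag_matrix_mult_vec power2_eq_square mult_ac)
  then show "0 \<le> x \<bullet> (diag_matrix d *v x)"
    using assms by (simp add: sum_nonneg)
qed (rule transpose_diag_matrix)

text \<open>
  Uniqueness: let \<open>B\<close> be a positive semidefinite square root of \<open>Diag(d)\<close>, and let \<open>e\<close> be a standard
  basis vector with \<open>B\<^sup>2 e = c\<^sup>2 e\<close>, \<open>c \<ge> 0\<close>. The vector \<open>v = B e - c e\<close> satisfies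
  \<open>B v + c v = (B\<^sup>2 - c\<^sup>2) e = 0\<close>. Pairing with \<open>v\<close> gives \<open>v \<bullet> B v + c \<parallel>v\<parallel>\<^sup>2 = 0\<close> with both terms
  nonnegative, so \<open>v = 0\<close> if \<open>c > 0\<close>; if \<open>c = 0\<close> then \<open>\<parallel>v\<parallel>\<^sup>2 = e \<bullet> B\<^sup>2 e = 0\<close> by symmetry.
\<close>
lemma matrix_sqrt_diag:
  assumes d: "\<And>i. 0 \<le> d $ i"
  shows "matrix_sqrt (diag_matrix d) = diag_matrix (\<chi> i. sqrt (d $ i))"
  unfolding matrix_sqrt_def
proof (rule the_equality)
  show "pos_semidef (diag_matrix (\<chi> i. sqrt (d $ i))) \<and>
      diag_matrix (\<chi> i. sqrt (d $ i)) ** diag_matrix (\<chi> i. sqrt (d $ i)) = diag_matrix d"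
    using d by (auto intro!: pos_semidef_diag_matrix simp: diag_matrix_mult)
next
  fix B assume B: "pos_semidef B \<and> B ** B = diag_matrix d"
  then have sym: "transpose B = B" and pos: "\<And>v. 0 \<le> v \<bullet> (B *v v)"
    and sq: "\<And>v. B *v (B *v v) = diag_matrix d *v v"
    by (simp_all add: pos_semidef_def quad_form_def matrix_vector_mul_assoc)
  have "B *v axis i 1 = sqrt (d $ i) *\<^sub>R axis i 1" for i
  proof -
    define c where "c = sqrt (d $ i)"
    define v where "v = B *v axis i 1 - c *\<^sub>R axis i 1"
    have c: "0 \<le> c" "c * c = d $ i" using d by (simp_all add: c_def)
    have sq_axis: "B *v (B *v axis i 1) = (c * c) *\<^sub>R axis i 1"
      unfolding sq c by (simp add: vec_eq_iff diag_matrix_mult_vec axis_def)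
    have "v = 0"
    proof (cases "c = 0")
      case True
      then have "v \<bullet> v = axis i 1 \<bullet> (B *v (B *v axis i 1))"
        by (simp add: v_def symmetric_inner_mult[OF sym])
      with True show ?thesis by (simp add: sq_axis)
    next
      case False
      have "B *v v + c *\<^sub>R v = 0"
        unfolding v_def by (simp add: matrix_vector_mult_diff_distrib sq_axis algebra_simps
            matrix_vector_mult_scaleR)
      then have "v \<bullet> (B *v v) + c * (v \<bullet> v) = 0"
        by (metis inner_add_right inner_scaleR_right inner_zero_right)
      with pos[of v] c False have "c * (v \<bullet> v) \<le> 0" by linarith
      with c False have "v \<bullet> v \<le> 0" by (simp add: mult_le_0_iff)
      then show ?thesis by (metis inner_eq_zero_iff inner_ge_zero order_antisym)
    qed
    then show ?thesis by (simp add: v_def c_def)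
  qed
  then have "column i B $ j = (sqrt (d $ i) *\<^sub>R axis i 1) $ j" for i j
    by (simp add: matrix_vector_mult_basis)
  then have "B $ j $ i = (if j = i then sqrt (d $ i) else 0)" for i j
    by (simp add: column_def axis_def)
  then show "B = diag_matrix (\<chi> i. sqrt (d $ i))"
    by (auto simp: diag_matrix_def vec_eq_iff)
qed

lemma matrix_inv_diag_matrix:
  fixes d :: "real ^ 'n"
  assumes "\<And>i. d $ i \<noteq> 0"
  shows "matrix_inv (diag_matrix d) = diag_matrix (\<chi> i. 1 / d $ i)"
proof -
  let ?d' = "diag_matrix (\<chi> i. 1 / d $ i)"
  have left: "?d' ** diag_matrix d = mat 1" and right: "diag_matrix d ** ?d' = mat 1"
    using assms by (simp_all add: diag_matrix_mult mat_1_eq_diag_matrix)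
  show ?thesis
    unfolding matrix_inv_def
  proof (rule some_equality)
    fix B assume "diag_matrix d ** B = mat 1 \<and> B ** diag_matrix d = mat 1"
    then show "B = ?d'"
      by (metis left matrix_mul_assoc matrix_mul_lid matrix_mul_rid)
  qed (simp add: left right)
qed

lemma matrix_inv_sqrt_diag_matrix:
  assumes "\<And>i. 0 < d $ i"
  shows "matrix_inv_sqrt (diag_matrix d) = diag_matrix (\<chi> i. 1 / sqrt (d $ i))"
proof -
  have "0 \<le> d $ i" "sqrt (d $ i) \<noteq> 0" for i
    using assms[of i] by auto
  then show ?thesis
    unfolding matrix_inv_sqrt_def by (simp add: matrix_sqrt_diag matrix_inv_diag_matrix)
qed

section \<open>The quadratic form as a sum over the columns of the sketching matrix\<close>

lemma quad_form_congruence: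
  assumes "transpose S = S"
  shows "quad_form (S ** A ** S) x = quad_form A (S *v x)"
  by (simp add: quad_form_def symmetric_inner_mult[OF assms] flip: matrix_vector_mul_assoc)

lemma quad_form_sketched_matrix_diag:
  fixes \<sigma> x :: "real ^ 'n" and W :: "real ^ 'k ^ 'n"
  shows "quad_form (sketched_matrix (diag_matrix \<sigma>) W) x =
    (\<Sum>i\<in>UNIV. (x $ i)\<^sup>2 / (1 + (\<sigma> $ i)\<^sup>2)) +
    (\<Sum>j\<in>UNIV. (\<Sum>i\<in>UNIV. \<sigma> $ i * x $ i / sqrt (1 + (\<sigma> $ i)\<^sup>2) * W $ i $ j)\<^sup>2)"
proof -
  define D where "D = diag_matrix \<sigma>"
  define r :: "real ^ 'n" where "r = (\<chi> i. 1 / sqrt (1 + (\<sigma> $ i)\<^sup>2))"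
  define y where "y = diag_matrix r *v x"
  have y: "y $ i = x $ i / sqrt (1 + (\<sigma> $ i)\<^sup>2)" for i
    by (simp add: y_def diag_matrix_mult_vec r_def)
  have pos: "0 < 1 + (\<sigma> $ i)\<^sup>2" for i
    by (simp add: add_pos_nonneg)
  have "mat 1 + D ** D = diag_matrix (\<chi> i. 1 + (\<sigma> $ i)\<^sup>2)"
    by (simp add: D_def diag_matrix_mult mat_1_eq_diag_matrix diag_matrix_add)
      (simp add: plus_vec_def power2_eq_square)
  then have "matrix_inv_sqrt (mat 1 + D ** D) = diag_matrix r"
    using pos by (simp add: matrix_inv_sqrt_diag_matrix r_def)
  then have "quad_form (sketched_matrix D W) x = quad_form (mat 1 + D ** W ** transpose W ** D) y"
    by (simp add: sketched_matrix_def quad_form_congruence transpose_diag_matrix y_def)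
  also have "\<dots> = y \<bullet> y + (transpose W *v (D *v y)) \<bullet> (transpose W *v (D *v y))"
    using symmetric_inner_mult[of D] transpose_diag_matrix[of \<sigma>]
    by (simp add: quad_form_def matrix_vector_mult_add_rdistrib inner_add_right dot_lmul_matrix D_def
        flip: matrix_vector_mul_assoc)
  also have "y \<bullet> y = (\<Sum>i\<in>UNIV. (x $ i)\<^sup>2 / (1 + (\<sigma> $ i)\<^sup>2))"
    using pos by (simp add: inner_vec_def y less_imp_le flip: power2_eq_square)
      (simp add: power_divide less_imp_le)
  also have "(transpose W *v (D *v y)) \<bullet> (transpose W *v (D *v y)) =
      (\<Sum>j\<in>UNIV. (\<Sum>i\<in>UNIV. \<sigma> $ i * x $ i / sqrt (1 + (\<sigma> $ i)\<^sup>2) * W $ i $ j)\<^sup>2)"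
    by (simp add: inner_vec_def vector_matrix_mult_def D_def diag_matrix_mult_vec y mult_ac
        flip: power2_eq_square)
  finally show ?thesis by (simp add: D_def)
qed

section \<open>Independence and moments\<close>

text \<open>
  Bienayme's identity. After centring, the square of the sum expands into a double sum in which the
  off-diagonal products have expectation zero by independence; they are integrable for the same
  reason, so the sum is square-integrable.
\<close>
lemma (in prob_space) variance_sum_indep:
  fixes X :: "'i \<Rightarrow> 'a \<Rightarrow> real"
  assumes "finite J" and indep: "indep_vars (\<lambda>_. borel) X J"
    and int: "\<And>j. j \<in> J \<Longrightarrow> integrable M (X j)"
    and int2: "\<And>j. j \<in> J \<Longrightarrow> integrable M (\<lambda>\<omega>. (X j \<omega>)\<^sup>2)"
  shows "integrable M (\<lambda>\<omega>. (\<Sum>j\<in>J. X j \<omega>)\<^sup>2)"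
    and "variance (\<lambda>\<omega>. \<Sum>j\<in>J. X j \<omega>) = (\<Sum>j\<in>J. variance (X j))"
proof -
  define Z where "Z j \<omega> = X j \<omega> - expectation (X j)" for j \<omega>
  have intZ: "integrable M (Z j)" and expZ: "expectation (Z j) = 0" if "j \<in> J" for j
    using int[OF that] by (simp_all add: Z_def[abs_def] prob_space)
  have indepZ: "indep_vars (\<lambda>_. borel) Z J"
    unfolding Z_def by (rule indep_vars_compose2[OF indep]) simp
  have off_diag: "integrable M (\<lambda>\<omega>. Z j \<omega> * Z l \<omega>) \<and> expectation (\<lambda>\<omega>. Z j \<omega> * Z l \<omega>) = 0"
    if "j \<in> J" "l \<in> J" "j \<noteq> l" for j l
    using that indep_vars_integrable[of "{j, l}" Z] indep_vars_lebesgue_integral[of "{j, l}" Z]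
      indep_vars_subset[OF indepZ, of "{j, l}"] intZ expZ by auto
  have diag: "integrable M (\<lambda>\<omega>. Z j \<omega> * Z j \<omega>)" if "j \<in> J" for j
  proof -
    have "Z j \<omega> * Z j \<omega> = (X j \<omega>)\<^sup>2 - 2 * expectation (X j) * X j \<omega> + (expectation (X j))\<^sup>2" for \<omega>
      by (simp add: Z_def power2_eq_square algebra_simps)
    then show ?thesis using int[OF that] int2[OF that] by simp
  qed
  have prod_int: "integrable M (\<lambda>\<omega>. Z j \<omega> * Z l \<omega>)" if "j \<in> J" "l \<in> J" for j l
    using off_diag diag that by (cases "j = l") auto
  have sq_sum: "(\<Sum>j\<in>J. Z j \<omega>)\<^sup>2 = (\<Sum>j\<in>J. \<Sum>l\<in>J. Z j \<omega> * Z l \<omega>)" for \<omega>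
    by (simp add: power2_eq_square sum_product)
  have exp_sum: "expectation (\<lambda>\<omega>. \<Sum>j\<in>J. X j \<omega>) = (\<Sum>j\<in>J. expectation (X j))"
    using int by simp
  have centred: "(\<Sum>j\<in>J. X j \<omega>) - (\<Sum>j\<in>J. expectation (X j)) = (\<Sum>j\<in>J. Z j \<omega>)" for \<omega>
    by (simp add: Z_def sum_subtractf)
  have "expectation (\<lambda>\<omega>. (\<Sum>j\<in>J. Z j \<omega>)\<^sup>2) =
      (\<Sum>j\<in>J. \<Sum>l\<in>J. expectation (\<lambda>\<omega>. Z j \<omega> * Z l \<omega>))"
    using prod_int by (simp add: sq_sum)
  also have "\<dots> = (\<Sum>j\<in>J. \<Sum>l\<in>J. if l = j then variance (X j) else 0)"
    using off_diag by (intro sum.cong refl) (auto simp: Z_def power2_eq_square)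
  also have "\<dots> = (\<Sum>j\<in>J. variance (X j))"
    using \<open>finite J\<close> by simp
  finally show "variance (\<lambda>\<omega>. \<Sum>j\<in>J. X j \<omega>) = (\<Sum>j\<in>J. variance (X j))"
    by (simp add: exp_sum centred)
  define m where "m = (\<Sum>j\<in>J. expectation (X j))"
  have "(\<Sum>j\<in>J. X j \<omega>)\<^sup>2 = (\<Sum>j\<in>J. Z j \<omega>)\<^sup>2 + 2 * m * (\<Sum>j\<in>J. Z j \<omega>) + m\<^sup>2" for \<omega>
  proof -
    have "(\<Sum>j\<in>J. X j \<omega>) = (\<Sum>j\<in>J. Z j \<omega>) + m" using centred[of \<omega>] by (simp add: m_def)
    then show ?thesis by (simp add: power2_sum)
  qed
  moreover have "integrable M (\<lambda>\<omega>. (\<Sum>j\<in>J. Z j \<omega>)\<^sup>2)"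
    using prod_int by (simp add: sq_sum)
  ultimately show "integrable M (\<lambda>\<omega>. (\<Sum>j\<in>J. X j \<omega>)\<^sup>2)"
    using intZ by simp
qed

lemma (in prob_space) indep_vars_reindex:
  assumes indep: "indep_vars M' X I" and "inj_on h J" "h ` J \<subseteq> I"
  shows "indep_vars (\<lambda>j. M' (h j)) (\<lambda>j. X (h j)) J"
proof -
  have "indep_vars (\<lambda>j. PiM {h j} M') (\<lambda>j \<omega>. restrict (\<lambda>i. X i \<omega>) {h j}) J"
    using assms(2,3) by (intro indep_vars_restrict[OF indep])
      (auto simp: disjoint_family_on_def inj_on_def)
  then have "indep_vars (\<lambda>j. M' (h j))
      (\<lambda>j \<omega>. (\<lambda>g. g (h j)) (restrict (\<lambda>i. X i \<omega>) {h j})) J"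
    by (rule indep_vars_compose2) (rule measurable_component_singleton, simp)
  then show ?thesis by simp
qed

lemma (in prob_space) normal_moments_2_4:
  assumes s: "0 < s" and X: "distributed M lborel X (normal_density 0 s)"
  shows "integrable M (\<lambda>\<omega>. (X \<omega>)\<^sup>2)" "expectation (\<lambda>\<omega>. (X \<omega>)\<^sup>2) = s\<^sup>2"
    and "integrable M (\<lambda>\<omega>. (X \<omega>)^4)" "expectation (\<lambda>\<omega>. (X \<omega>)^4) = 3 * s^4"
proof -
  have moment: "integrable M (\<lambda>\<omega>. (X \<omega>)^(2 * k))"
    "expectation (\<lambda>\<omega>. (X \<omega>)^(2 * k)) = fact (2 * k) / ((2 / s\<^sup>2)^k * fact k)" for k
    using integrable_normal_moment[OF s, of 0 "2 * k"] integral_normal_moment_even[OF s, of 0 k]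
      distributed_integrable[OF X, of "\<lambda>x. x^(2 * k)"] distributed_integral[OF X, of "\<lambda>x. x^(2 * k)"]
    by simp_all
  show "integrable M (\<lambda>\<omega>. (X \<omega>)\<^sup>2)" "expectation (\<lambda>\<omega>. (X \<omega>)\<^sup>2) = s\<^sup>2"
    using moment[of 1] by (simp_all add: fact_numeral)
  show "integrable M (\<lambda>\<omega>. (X \<omega>)^4)" "expectation (\<lambda>\<omega>. (X \<omega>)^4) = 3 * s^4"
    using moment[of 2] s by (simp_all add: fact_numeral field_simps)
qed

text \<open>
  The combination is again Gaussian, except when all coefficients vanish: it is then constantly zero
  and has no density, but the moment formulas persist. Indices with zero coefficient are dropped
  because scaling preserves normality only for nonzero factors.
\<close>
lemma (in prob_space) linear_combination_normal_moments:
  fixes X :: "'i \<Rightarrow> 'a \<Rightarrow> real" and a :: "'i \<Rightarrow> real"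
  assumes "finite I" and s: "0 < s" and indep: "indep_vars (\<lambda>_. borel) X I"
    and X: "\<And>i. i \<in> I \<Longrightarrow> distributed M lborel (X i) (normal_density 0 s)"
  defines "Y \<equiv> \<lambda>\<omega>. \<Sum>i\<in>I. a i * X i \<omega>" and "v \<equiv> s\<^sup>2 * (\<Sum>i\<in>I. (a i)\<^sup>2)"
  shows "integrable M (\<lambda>\<omega>. (Y \<omega>)\<^sup>2)" "expectation (\<lambda>\<omega>. (Y \<omega>)\<^sup>2) = v"
    and "integrable M (\<lambda>\<omega>. (Y \<omega>)^4)" "expectation (\<lambda>\<omega>. (Y \<omega>)^4) = 3 * v\<^sup>2"
proof -
  define K where "K = {i \<in> I. a i \<noteq> 0}"
  have K: "finite K" "K \<subseteq> I" using \<open>finite I\<close> by (auto simp: K_def)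
  have Y: "Y = (\<lambda>\<omega>. \<Sum>i\<in>K. a i * X i \<omega>)"
    unfolding Y_def by (intro ext sum.mono_neutral_right) (use \<open>finite I\<close> in \<open>auto simp: K_def\<close>)
  have v: "v = (\<Sum>i\<in>K. (\<bar>a i\<bar> * s)\<^sup>2)"
  proof -
    have "(\<Sum>i\<in>I. (a i)\<^sup>2) = (\<Sum>i\<in>K. (a i)\<^sup>2)"
      by (intro sum.mono_neutral_right) (use \<open>finite I\<close> in \<open>auto simp: K_def\<close>)
    then show ?thesis by (simp add: v_def sum_distrib_left power_mult_distrib mult_ac)
  qed
  have "integrable M (\<lambda>\<omega>. (Y \<omega>)\<^sup>2) \<and> expectation (\<lambda>\<omega>. (Y \<omega>)\<^sup>2) = v \<and>
    integrable M (\<lambda>\<omega>. (Y \<omega>)^4) \<and> expectation (\<lambda>\<omega>. (Y \<omega>)^4) = 3 * v\<^sup>2"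
  proof (cases "K = {}")
    case True
    then show ?thesis by (simp add: Y v)
  next
    case False
    have "distributed M lborel (\<lambda>\<omega>. a i * X i \<omega>) (normal_density 0 (\<bar>a i\<bar> * s))" if "i \<in> K" for i
      using normal_density_affine[OF X s, of i "a i" 0] that by (simp add: K_def)
    moreover have "indep_vars (\<lambda>_. borel) (\<lambda>i \<omega>. a i * X i \<omega>) K"
      by (rule indep_vars_compose2[OF indep_vars_subset[OF indep K(2)]]) simp
    ultimately have D: "distributed M lborel Y (normal_density 0 (sqrt v))"
      using sum_indep_normal[OF K(1) False, of "\<lambda>i \<omega>. a i * X i \<omega>" "\<lambda>i. \<bar>a i\<bar> * s" "\<lambda>_. 0"] s
      by (simp add: Y v K_def)
    have pos: "0 < v"
      unfolding v using K False s by (intro sum_pos) (auto simp: K_def)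
    then have "sqrt v ^ 4 = v\<^sup>2"
      using power_mult[of "sqrt v" 2 2] by simp
    with normal_moments_2_4[OF _ D] pos show ?thesis by simp
  qed
  then show "integrable M (\<lambda>\<omega>. (Y \<omega>)\<^sup>2)" "expectation (\<lambda>\<omega>. (Y \<omega>)\<^sup>2) = v"
    "integrable M (\<lambda>\<omega>. (Y \<omega>)^4)" "expectation (\<lambda>\<omega>. (Y \<omega>)^4) = 3 * v\<^sup>2"
    by simp_all
qed

text \<open>
  Combinations of distinct columns depend on disjoint blocks of an independent family.
\<close>
lemma (in prob_space) indep_vars_column_combinations:
  fixes W :: "'i \<Rightarrow> 'j \<Rightarrow> 'a \<Rightarrow> real" and a :: "'i \<Rightarrow> real"
  assumes indep: "indep_vars (\<lambda>_. borel) (\<lambda>(i, j). W i j) (I \<times> J)"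
  shows "indep_vars (\<lambda>_. borel) (\<lambda>j \<omega>. \<Sum>i\<in>I. a i * W i j \<omega>) J"
proof -
  define block :: "'j \<Rightarrow> ('i \<times> 'j) set" where "block j = I \<times> {j}" for j
  have "indep_vars (\<lambda>j. PiM (block j) (\<lambda>_. borel))
      (\<lambda>j \<omega>. restrict (\<lambda>p. (case p of (i, j) \<Rightarrow> W i j) \<omega>) (block j)) J"
    by (rule indep_vars_restrict[OF indep]) (auto simp: block_def disjoint_family_on_def)
  then have "indep_vars (\<lambda>_. borel) (\<lambda>j \<omega>. (\<lambda>g. \<Sum>i\<in>I. a i * g (i, j))
      (restrict (\<lambda>p. (case p of (i, j) \<Rightarrow> W i j) \<omega>) (block j))) J"
    by (rule indep_vars_compose2) (auto simp: block_def intro!: borel_measurable_sum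
        borel_measurable_times measurable_component_singleton)
  then show ?thesis
    by (simp add: block_def)
qed

section \<open>Mean and variance of the sketched quadratic form\<close>

theorem theorem4:
  fixes M :: "'a measure"
    and \<sigma> :: "real ^ 'n::{finite,linorder}"
    and \<Omega> :: "'a \<Rightarrow> real ^ 'k ^ 'n::{finite,linorder}"
    and x :: "real ^ 'n::{finite,linorder}"
  assumes "prob_space M"
    and "\<forall>i j. i \<le> j \<longrightarrow> \<sigma> $ j \<le> \<sigma> $ i"
    and "\<forall>i. 0 \<le> \<sigma> $ i"
    and "prob_space.indep_vars M (\<lambda>_. borel) (\<lambda>(i, j) \<omega>. \<Omega> \<omega> $ i $ j) UNIV"
    and "\<forall>i j. distributed M lborel (\<lambda>\<omega>. \<Omega> \<omega> $ i $ j)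
           (normal_density 0 (sqrt (1 / real CARD('k))))"
  shows "let q = (\<lambda>\<omega>. quad_form (sketched_matrix (diag_matrix \<sigma>) (\<Omega> \<omega>)) x) in
           integrable M q
         \<and> prob_space.expectation M q = (norm x)\<^sup>2
         \<and> integrable M (\<lambda>\<omega>. (q \<omega>)\<^sup>2)
         \<and> prob_space.variance M q =
             2 / real CARD('k) * (\<Sum>i\<in>UNIV. (\<sigma> $ i)\<^sup>2 / (1 + (\<sigma> $ i)\<^sup>2) * (x $ i)\<^sup>2)\<^sup>2"
proof -
  interpret prob_space M by fact
  define s where "s = sqrt (1 / real CARD('k))"
  define a where "a i = \<sigma> $ i * x $ i / sqrt (1 + (\<sigma> $ i)\<^sup>2)" for i
  define A where "A = (\<Sum>i\<in>UNIV. (\<sigma> $ i)\<^sup>2 / (1 + (\<sigma> $ i)\<^sup>2) * (x $ i)\<^sup>2)"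
  define v where "v = A / real CARD('k)"
  define c where "c = (\<Sum>i\<in>UNIV. (x $ i)\<^sup>2 / (1 + (\<sigma> $ i)\<^sup>2))"
  define Y where "Y j \<omega> = (\<Sum>i\<in>UNIV. a i * \<Omega> \<omega> $ i $ j)" for j \<omega>
  define Q where "Q \<omega> = (\<Sum>j\<in>UNIV. (Y j \<omega>)\<^sup>2)" for \<omega>
  have k: "0 < real CARD('k)" by simp
  have s: "0 < s" "s\<^sup>2 = 1 / real CARD('k)" by (simp_all add: s_def)
  have pos: "0 < 1 + (\<sigma> $ i)\<^sup>2" for i
    by (simp add: add_pos_nonneg)
  have a_sq: "(a i)\<^sup>2 = (\<sigma> $ i)\<^sup>2 / (1 + (\<sigma> $ i)\<^sup>2) * (x $ i)\<^sup>2" for i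
    using pos[of i] by (simp add: a_def power_divide power_mult_distrib less_imp_le)
  then have v: "s\<^sup>2 * (\<Sum>i\<in>UNIV. (a i)\<^sup>2) = v"
    by (simp add: s v_def A_def)
  have q: "quad_form (sketched_matrix (diag_matrix \<sigma>) (\<Omega> \<omega>)) x = c + Q \<omega>" for \<omega>
    by (simp add: quad_form_sketched_matrix_diag c_def Q_def Y_def a_def)
  have entries: "indep_vars (\<lambda>_. borel) (\<lambda>(i, j). \<lambda>\<omega>. \<Omega> \<omega> $ i $ j) (UNIV \<times> UNIV)"
    using assms(4) by simp
  have column: "indep_vars (\<lambda>_. borel) (\<lambda>i \<omega>. \<Omega> \<omega> $ i $ j) UNIV" for j
    using indep_vars_reindex[OF entries, of "\<lambda>i. (i, j)" UNIV] by (simp add: inj_on_def)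
  have moments: "integrable M (\<lambda>\<omega>. (Y j \<omega>)\<^sup>2)" "expectation (\<lambda>\<omega>. (Y j \<omega>)\<^sup>2) = v"
    "integrable M (\<lambda>\<omega>. (Y j \<omega>)^4)" "expectation (\<lambda>\<omega>. (Y j \<omega>)^4) = 3 * v\<^sup>2" for j
    using linear_combination_normal_moments[OF finite s(1) column[of j], of a] assms(5)
    by (simp_all add: v s_def[symmetric] flip: Y_def)
  have fourth: "((Y j \<omega>)\<^sup>2)\<^sup>2 = (Y j \<omega>)^4" for j \<omega>
    by (simp flip: power_mult)
  have var_sq: "variance (\<lambda>\<omega>. (Y j \<omega>)\<^sup>2) = 2 * v\<^sup>2" for j
    using moments[of j] by (subst variance_eq) (simp_all add: fourth)
  have "indep_vars (\<lambda>_. borel) Y UNIV"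
    using indep_vars_column_combinations[OF entries, of a] by (simp add: Y_def[abs_def])
  then have indep_sq: "indep_vars (\<lambda>_. borel) (\<lambda>j \<omega>. (Y j \<omega>)\<^sup>2) UNIV"
    by (rule indep_vars_compose2) simp
  have Q_int: "integrable M Q" and Q_exp: "expectation Q = A"
    using moments k by (simp_all add: Q_def[abs_def] v_def)
  have Q_sq_int: "integrable M (\<lambda>\<omega>. (Q \<omega>)\<^sup>2)"
    and "variance Q = (\<Sum>j\<in>UNIV. variance (\<lambda>\<omega>. (Y j \<omega>)\<^sup>2))"
    using variance_sum_indep[OF finite indep_sq] moments by (simp_all add: Q_def[abs_def] fourth)
  then have "variance Q = real CARD('k) * (2 * v\<^sup>2)"
    by (simp add: var_sq)
  then have Q_var: "variance Q = 2 / real CARD('k) * A\<^sup>2"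
    using k by (simp add: v_def power2_eq_square)
  have "c + A = (\<Sum>i\<in>UNIV. (x $ i)\<^sup>2)"
    unfolding c_def A_def sum.distrib[symmetric]
  proof (rule sum.cong)
    fix i
    show "(x $ i)\<^sup>2 / (1 + (\<sigma> $ i)\<^sup>2) + (\<sigma> $ i)\<^sup>2 / (1 + (\<sigma> $ i)\<^sup>2) * (x $ i)\<^sup>2 = (x $ i)\<^sup>2"
      using pos[of i] by (simp add: divide_simps) (simp add: algebra_simps)
  qed simp
  also have "\<dots> = (norm x)\<^sup>2"
    unfolding power2_norm_eq_inner inner_vec_def by (simp add: power2_eq_square)
  finally have mean: "c + A = (norm x)\<^sup>2" .
  have q_exp: "expectation (\<lambda>\<omega>. c + Q \<omega>) = c + A"
    using Q_int by (simp add: Q_exp prob_space)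
  have "variance (\<lambda>\<omega>. c + Q \<omega>) = variance Q"
    by (simp add: q_exp Q_exp)
  moreover have "integrable M (\<lambda>\<omega>. (c + Q \<omega>)\<^sup>2)"
    using Q_int Q_sq_int by (simp add: power2_sum)
  ultimately show ?thesis
    unfolding Let_def q A_def[symmetric] using Q_int q_exp Q_var mean by auto
qed

end
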